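(* Let $G$ be a simple game with $n$ players and $N=(n+1)2^{\frac{1}{2}n\log_2 n}$. The following two statements are equivalent, and $G$ is roughly weighted if and only if they hold: (a) for no positive integer $j\le N$ does there exist a potent certificate of non-weightedness of length $j$; (b) for no positive integer $j\le N$ do there exist $j$ vectors $\mathbf{v}_1,\dots,\mathbf{v}_j\in I(G)$ with $\mathbf{v}_1+\dots+\mathbf{v}_j+\mathbf{1}=\mathbf{0}$, where $\mathbf{1}=(1,\dots,1)$.
   Context: A simple game is $G=(P,W)$ with $P=[n]$, $W\subseteq 2^P$ (winning coalitions) closed under supersets within $P$, $W\ne\emptyset$, $W\ne 2^P$; $L=2^P\setminus W$ are the losing coalitions. $G$ is roughly weighted if there exist non-negative reals $w_1,\dots,w_n$ and a real $q$, not all equal to zero, such that $\sum_{i\in X}w_i<q$ implies $X\in L$ and $\sum_{i\in X}w_i>q$ implies $X\in W$. For $X,Y\subseteq[n]$, $\mathbf{v}_{X,Y}=\chi(X)-\chi(Y)$ with $\chi$ the characteristic vector, and $I(G)=\{\mathbf{v}_{X,Y}: X\in W, Y\in L\}$. A trading transform of length $j$ is $(X_1,\dots,X_j;Y_1,\dots,Y_j)$ with every player belonging to equally many $X_i$'s as $Y_i$'s; it is a certificate of non-weightedness if all $X_i$ are winning and all $Y_i$ losing; it is potent if moreover the grand coalition $P$ is among the $X_i$ and $\emptyset$ is among the $Y_i$. *)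

theory Defs
  imports "HOL-Analysis.Analysis"
begin

definition players :: "nat \<Rightarrow> nat set" where
  "players n = {1..n}"

definition simple_game :: "nat \<Rightarrow> nat set set \<Rightarrow> bool" where
  "simple_game n W \<longleftrightarrow>
     W \<subseteq> Pow (players n) \<and>
     (\<forall>X Y. X \<in> W \<and> X \<subseteq> Y \<and> Y \<subseteq> players n \<longrightarrow> Y \<in> W) \<and>
     W \<noteq> {} \<and> W \<noteq> Pow (players n)"

definition losing :: "nat \<Rightarrow> nat set set \<Rightarrow> nat set set" where
  "losing n W = Pow (players n) - W"

definition roughly_weighted :: "nat \<Rightarrow> nat set set \<Rightarrow> bool" where
  "roughly_weighted n W \<longleftrightarrow>
     (\<exists>(w :: nat \<Rightarrow> real) (q :: real).
        (\<forall>i\<in>players n. w i \<ge> 0) \<and>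
        (q \<noteq> 0 \<or> (\<exists>i\<in>players n. w i \<noteq> 0)) \<and>
        (\<forall>X\<subseteq>players n.
           ((\<Sum>i\<in>X. w i) < q \<longrightarrow> X \<in> losing n W) \<and>
           ((\<Sum>i\<in>X. w i) > q \<longrightarrow> X \<in> W)))"

text \<open>A vector of \<open>\<real>\<^sup>n\<close> is represented by a function on \<open>nat\<close> of which only the
  coordinates in \<^term>\<open>players n\<close> matter.\<close>

definition diff_vec :: "nat set \<Rightarrow> nat set \<Rightarrow> nat \<Rightarrow> real" where
  "diff_vec X Y = (\<lambda>i. indicator X i - indicator Y i)"

definition game_vecs :: "nat \<Rightarrow> nat set set \<Rightarrow> (nat \<Rightarrow> real) set" where
  "game_vecs n W = {diff_vec X Y | X Y. X \<in> W \<and> Y \<in> losing n W}"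

definition trading_transform :: "nat \<Rightarrow> nat \<Rightarrow> nat set list \<Rightarrow> nat set list \<Rightarrow> bool" where
  "trading_transform n j Xs Ys \<longleftrightarrow>
     length Xs = j \<and> length Ys = j \<and>
     set Xs \<subseteq> Pow (players n) \<and> set Ys \<subseteq> Pow (players n) \<and>
     (\<forall>i\<in>players n. card {k. k < j \<and> i \<in> Xs ! k} = card {k. k < j \<and> i \<in> Ys ! k})"

definition certificate_nonweighted ::
    "nat \<Rightarrow> nat set set \<Rightarrow> nat \<Rightarrow> nat set list \<Rightarrow> nat set list \<Rightarrow> bool" where
  "certificate_nonweighted n W j Xs Ys \<longleftrightarrow>
     trading_transform n j Xs Ys \<and> set Xs \<subseteq> W \<and> set Ys \<subseteq> losing n W"

definition potent_certificate ::
    "nat \<Rightarrow> nat set set \<Rightarrow> nat \<Rightarrow> nat set list \<Rightarrow> nat set list \<Rightarrow> bool" where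
  "potent_certificate n W j Xs Ys \<longleftrightarrow>
     certificate_nonweighted n W j Xs Ys \<and> players n \<in> set Xs \<and> {} \<in> set Ys"

definition length_bound :: "nat \<Rightarrow> real" where
  "length_bound n = (real n + 1) * 2 powr (1 / 2 * real n * log 2 (real n))"

definition no_potent_certificate :: "nat \<Rightarrow> nat set set \<Rightarrow> bool" where
  "no_potent_certificate n W \<longleftrightarrow>
     \<not> (\<exists>j::nat. 0 < j \<and> real j \<le> length_bound n \<and> (\<exists>Xs Ys. potent_certificate n W j Xs Ys))"

definition no_vector_relation :: "nat \<Rightarrow> nat set set \<Rightarrow> bool" where
  "no_vector_relation n W \<longleftrightarrow>
     \<not> (\<exists>j::nat. 0 < j \<and> real j \<le> length_bound n \<and>
          (\<exists>v :: nat \<Rightarrow> nat \<Rightarrow> real.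
             (\<forall>k<j. v k \<in> game_vecs n W) \<and>
             (\<forall>i\<in>players n. (\<Sum>k<j. v k i) + 1 = 0)))"

end

theory Submission
  imports Defs "HOL-Library.Function_Algebras" "Jordan_Normal_Form.Determinant"
begin

text \<open>
  Rough weightedness means that some nonzero \<open>w \<ge> 0\<close> has \<open>w \<bullet> v \<ge> 0\<close> for all \<open>v \<in> I(G)\<close>; pairing \<open>w\<close>
  with a vector relation or a potent certificate gives \<open>w = 0\<close>, so such a \<open>w\<close> excludes relations and
  certificates of any length.

  If there is no such \<open>w\<close>, Farkas' lemma writes \<open>-\<one>\<close> as a nonnegative combination of \<open>I(G)\<close> and the
  unit vectors. By Caratheodory's reduction the combination can be supported on a basis contained in
  this set. By Cramer's rule and Hadamard's inequality, clearing denominators leaves integer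
  coefficients of size at most \<open>n powr (n / 2)\<close> and a right-hand side \<open>-D\<one>\<close> with \<open>D \<ge> 1\<close>. The unit vectors and
  the surplus \<open>(D - 1)\<one>\<close> are absorbed by shrinking losing coalitions, which yields a relation of
  length at most \<open>n * n powr (n / 2) \<le> N - 1\<close>. The missing 1 pays for the pair \<open>(P, {})\<close> that turns the relation
  into a potent certificate of length at most \<open>N\<close>.
\<close>

unbundle no inner_syntax

section \<open>Conic combinations\<close>

text \<open>Bartl's induction on the number of forms: if dropping the form \<open>a m\<close> makes the
  implication fail at \<open>z\<close>, normalise \<open>dot (a m) z = 1\<close> and project along \<open>z\<close> onto the kernel of
  \<open>a m\<close>.\<close>

lemma farkas:
  fixes a :: "'i \<Rightarrow> 'p \<Rightarrow> real"
  assumes "finite I" "finite P"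
    and "\<And>y. (\<forall>k\<in>I. (\<Sum>p\<in>P. a k p * y p) \<le> 0) \<Longrightarrow> (\<Sum>p\<in>P. b p * y p) \<le> 0"
  shows "\<exists>c. (\<forall>k\<in>I. c k \<ge> 0) \<and> (\<forall>p\<in>P. b p = (\<Sum>k\<in>I. c k * a k p))"
  using assms(1,3)
proof (induction I arbitrary: a b rule: finite_induct)
  case empty
  have "(\<Sum>p\<in>P. b p * b p) \<le> 0"
    using empty by simp
  then have "(\<Sum>p\<in>P. b p * b p) = 0"
    by (intro antisym sum_nonneg) auto
  then have "\<forall>p\<in>P. b p = 0"
    using \<open>finite P\<close> by (simp add: sum_nonneg_eq_0_iff)
  then show ?case by simp
next
  case (insert m I)
  define dot :: "('p \<Rightarrow> real) \<Rightarrow> ('p \<Rightarrow> real) \<Rightarrow> real" where "dot f y = (\<Sum>p\<in>P. f p * y p)" for f y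
  have dot_lin: "dot (\<lambda>p. f p - t * g p) y = dot f y - t * dot g y"
    "dot f (\<lambda>p. y p - t * z p) = dot f y - t * dot f z" for f g y z t
    by (simp_all add: dot_def algebra_simps sum_subtractf sum_distrib_left)
  have IH: "\<exists>c. (\<forall>k\<in>I. c k \<ge> 0) \<and> (\<forall>p\<in>P. b' p = (\<Sum>k\<in>I. c k * a' k p))"
    if "\<And>y. (\<forall>k\<in>I. dot (a' k) y \<le> 0) \<Longrightarrow> dot b' y \<le> 0" for a' b'
    using insert.IH[of a' b'] that by (simp add: dot_def)
  have prem: "dot b y \<le> 0" if "dot (a m) y \<le> 0" "\<forall>k\<in>I. dot (a k) y \<le> 0" for y
    using insert.prems[of y] that by (simp add: dot_def)
  show ?case
  proof (cases "\<forall>y. (\<forall>k\<in>I. dot (a k) y \<le> 0) \<longrightarrow> dot b y \<le> 0")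
    case True
    then obtain c where c: "\<forall>k\<in>I. c k \<ge> 0" "\<forall>p\<in>P. b p = (\<Sum>k\<in>I. c k * a k p)"
      using IH[of a b] by blast
    have "(\<Sum>k\<in>insert m I. (c(m := 0)) k * a k p) = (\<Sum>k\<in>I. c k * a k p)" for p
      using insert.hyps by (auto intro!: sum.cong)
    with c show ?thesis
      by (intro exI[of _ "c(m := 0)"]) auto
  next
    case False
    then obtain z0 where z0: "\<forall>k\<in>I. dot (a k) z0 \<le> 0" "dot b z0 > 0"
      by (auto simp: not_le)
    then have pos: "dot (a m) z0 > 0"
      using prem[of z0] by force
    define z where "z = (\<lambda>p. z0 p / dot (a m) z0)"
    have dot_z: "dot f z = dot f z0 / dot (a m) z0" for f
      by (simp add: dot_def z_def sum_divide_distrib)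
    have z: "\<forall>k\<in>I. dot (a k) z \<le> 0" "dot b z > 0" "dot (a m) z = 1"
      using z0 pos by (auto simp: dot_z divide_nonpos_pos)
    define a' where "a' = (\<lambda>k p. a k p - dot (a k) z * a m p)"
    define b' where "b' = (\<lambda>p. b p - dot b z * a m p)"
    have "dot b' y \<le> 0" if y: "\<forall>k\<in>I. dot (a' k) y \<le> 0" for y
    proof -
      let ?y = "\<lambda>p. y p - dot (a m) y * z p"
      have "dot (a k) ?y = dot (a' k) y" "dot b ?y = dot b' y" for k
        unfolding a'_def b'_def dot_lin by simp_all
      moreover have "dot (a m) ?y = 0"
        unfolding dot_lin by (simp add: z(3))
      ultimately show ?thesis
        using prem[of ?y] y by simp
    qed
    then obtain c where c: "\<forall>k\<in>I. c k \<ge> 0" "\<forall>p\<in>P. b' p = (\<Sum>k\<in>I. c k * a' k p)"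
      using IH[of a' b'] by blast
    define t where "t = dot b z - (\<Sum>k\<in>I. c k * dot (a k) z)"
    have "(\<Sum>k\<in>I. c k * dot (a k) z) \<le> 0"
      using c(1) z(1) by (intro sum_nonpos) (auto simp: mult_nonneg_nonpos)
    then have "t \<ge> 0"
      using z(2) by (simp add: t_def)
    moreover have "b p = (\<Sum>k\<in>insert m I. (c(m := t)) k * a k p)" if "p \<in> P" for p
    proof -
      have "(\<Sum>k\<in>insert m I. (c(m := t)) k * a k p) = t * a m p + (\<Sum>k\<in>I. c k * a k p)"
        using insert.hyps by (auto intro!: sum.cong)
      moreover have "b p - dot b z * a m p
          = (\<Sum>k\<in>I. c k * a k p) - (\<Sum>k\<in>I. c k * dot (a k) z) * a m p"
        using c(2)[rule_format, OF that]
        by (simp add: a'_def b'_def algebra_simps sum_subtractf sum_distrib_left)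
      ultimately show ?thesis
        by (simp add: t_def algebra_simps)
    qed
    ultimately show ?thesis
      using c(1) by (intro exI[of _ "c(m := t)"]) auto
  qed
qed

text \<open>A linear dependency among the vectors can be subtracted until the first coefficient
  reaches zero. This keeps the sum and the signs but drops a vector, so induction on the cardinality
  ends at an independent set.\<close>

lemma caratheodory_conic:
  fixes A :: "'b::real_vector set"
  assumes "finite A" "\<forall>a\<in>A. c a \<ge> 0"
  shows "\<exists>S d. S \<subseteq> A \<and> independent S \<and> (\<forall>a\<in>S. d a \<ge> 0) \<and>
    (\<Sum>a\<in>S. d a *\<^sub>R a) = (\<Sum>a\<in>A. c a *\<^sub>R a)"
  using assms
proof (induction "card A" arbitrary: A c rule: less_induct)
  case less
  show ?case
  proof (cases "independent A")
    case True
    then show ?thesis using less.prems by blast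
  next
    case False
    then obtain u0 v0 where u0: "(\<Sum>v\<in>A. u0 v *\<^sub>R v) = 0" "v0 \<in> A" "u0 v0 \<noteq> 0"
      using less.prems(1) by (auto simp: dependent_finite)
    \<comment> \<open>The sign is chosen so that some coefficient of the dependency is positive;
      otherwise the set \<open>Q\<close> of candidates for removal could be empty.\<close>
    define u where "u = (if u0 v0 > 0 then u0 else (\<lambda>v. - u0 v))"
    have u: "(\<Sum>v\<in>A. u v *\<^sub>R v) = 0" "u v0 > 0"
      using u0 by (auto simp: u_def sum_negf)
    define Q where "Q = {v\<in>A. u v > 0}"
    have "finite Q" "Q \<noteq> {}"
      using u(2) u0(2) less.prems(1) by (auto simp: Q_def)
    then obtain w where w: "w \<in> Q" "\<forall>v\<in>Q. c w / u w \<le> c v / u v"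
      using ex_min_if_finite[of "(\<lambda>v. c v / u v) ` Q"] by (force simp: not_less)
    \<comment> \<open>The minimal ratio is the largest step that keeps all coefficients nonnegative,
      and it makes the one at \<open>w\<close> vanish.\<close>
    define t where "t = c w / u w"
    have "w \<in> A" "u w > 0"
      using w(1) by (auto simp: Q_def)
    have "t \<ge> 0"
      using less.prems(2) \<open>w \<in> A\<close> \<open>u w > 0\<close> by (simp add: t_def)
    define d where "d v = c v - t * u v" for v
    have "d v \<ge> 0" if "v \<in> A" for v
    proof (cases "u v > 0")
      case True
      then show ?thesis
        using w(2) that by (auto simp: d_def t_def Q_def pos_le_divide_eq)
    next
      case False
      then have "t * u v \<le> 0"
        using \<open>t \<ge> 0\<close> by (simp add: mult_nonneg_nonpos)
      then show ?thesis
        using less.prems(2) that by (force simp: d_def)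
    qed
    moreover have "d w = 0"
      using \<open>u w > 0\<close> by (simp add: d_def t_def)
    moreover have "(\<Sum>v\<in>A. d v *\<^sub>R v) = (\<Sum>v\<in>A. c v *\<^sub>R v)"
    proof -
      have "(\<Sum>v\<in>A. d v *\<^sub>R v) = (\<Sum>v\<in>A. c v *\<^sub>R v) - t *\<^sub>R (\<Sum>v\<in>A. u v *\<^sub>R v)"
        by (simp add: d_def scaleR_diff_left sum_subtractf scaleR_sum_right)
      then show ?thesis using u(1) by simp
    qed
    ultimately have "(\<Sum>v\<in>A - {w}. d v *\<^sub>R v) = (\<Sum>v\<in>A. c v *\<^sub>R v)"
      using less.prems(1) \<open>w \<in> A\<close> by (simp add: sum.remove)
    moreover have "card (A - {w}) < card A"
      using less.prems(1) \<open>w \<in> A\<close> by (meson card_Diff1_less)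
    ultimately show ?thesis
      using less.hyps[of "A - {w}" d] less.prems(1) \<open>\<And>v. v \<in> A \<Longrightarrow> d v \<ge> 0\<close> by fastforce
  qed
qed

section \<open>Hadamard's inequality\<close>

text \<open>Gram-Schmidt without normalisation, clearing one inner product per step. Adding a
  multiple of another row preserves the determinant, removing a projection cannot lengthen the row,
  and the mutual orthogonality of the earlier rows protects the inner products already
  cleared.\<close>

lemma orthogonalize_row:
  fixes A :: "real mat"
  assumes A: "A \<in> carrier_mat n n" and m: "m < n" and "k \<le> m"
    and orth: "\<forall>i<m. \<forall>l<m. i \<noteq> l \<longrightarrow> row A i \<bullet> row A l = 0"
  shows "\<exists>B\<in>carrier_mat n n. det B = det A \<and> (\<forall>i<n. i \<noteq> m \<longrightarrow> row B i = row A i) \<and>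
    row B m \<bullet> row B m \<le> row A m \<bullet> row A m \<and> (\<forall>l<k. row B m \<bullet> row A l = 0)"
  using \<open>k \<le> m\<close>
proof (induction k)
  case 0
  show ?case using A by (intro bexI[of _ A]) auto
next
  case (Suc k)
  then obtain B where B: "B \<in> carrier_mat n n" "det B = det A"
    "\<forall>i<n. i \<noteq> m \<longrightarrow> row B i = row A i" "row B m \<bullet> row B m \<le> row A m \<bullet> row A m"
    "\<forall>l<k. row B m \<bullet> row A l = 0"
    by auto
  define r where "r = row B m"
  define s where "s = row A k"
  \<comment> \<open>If \<open>s\<close> is the zero row, division by zero gives
    \<open>t = 0\<close>, and \<open>rs\<close> below still holds.\<close>
  define t where "t = - ((r \<bullet> s) / (s \<bullet> s))"
  have car: "r \<in> carrier_vec n" "s \<in> carrier_vec n" "t \<cdot>\<^sub>v s \<in> carrier_vec n"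
    using A B(1) m Suc.prems by (auto simp: r_def s_def)
  have km: "k < n" "m \<noteq> k"
    using Suc.prems m by auto
  let ?C = "addrow t m k B"
  have Cm: "row ?C m = r + t \<cdot>\<^sub>v s"
    using B(1) B(3)[rule_format, of k] km m A
    by (intro eq_vecI) (auto simp: r_def s_def row_def vec_eq_iff)
  have Ci: "row ?C i = row A i" if "i < n" "i \<noteq> m" for i
    using B(1) B(3)[rule_format, of i] that A by (intro eq_vecI) (auto simp: row_def vec_eq_iff)
  have s0: "r \<bullet> s = 0" if "s \<bullet> s = 0"
  proof -
    have "s = 0\<^sub>v n" using that car(2) by (simp add: scalar_prod_def vec_eq_iff sum_nonneg_eq_0_iff)
    then show ?thesis using car(1) by simp
  qed
  have rs: "r \<bullet> s + t * (s \<bullet> s) = 0"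
    using s0 by (cases "s \<bullet> s = 0") (auto simp: t_def)
  have "(r + t \<cdot>\<^sub>v s) \<bullet> s = 0"
    using car rs by (simp add: add_scalar_prod_distrib[of _ n])
  moreover have "(r + t \<cdot>\<^sub>v s) \<bullet> row A l = 0" if "l < k" for l
  proof -
    have "row A l \<in> carrier_vec n" using A that km by auto
    moreover have "s \<bullet> row A l = 0" "r \<bullet> row A l = 0"
      using orth that Suc.prems B(5) by (auto simp: s_def r_def)
    ultimately show ?thesis
      using car by (simp add: add_scalar_prod_distrib[of _ n])
  qed
  moreover have "(r + t \<cdot>\<^sub>v s) \<bullet> (r + t \<cdot>\<^sub>v s) \<le> r \<bullet> r"
  proof -
    \<comment> \<open>The terms are grouped so that the last bracket vanishes by \<open>rs\<close>;
      what remains is \<open>r \<bullet> r\<close> minus a nonnegative quotient.\<close>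
    have "(r + t \<cdot>\<^sub>v s) \<bullet> (r + t \<cdot>\<^sub>v s) = r \<bullet> r + t * (r \<bullet> s) + t * (r \<bullet> s + t * (s \<bullet> s))"
      using car by (simp add: add_scalar_prod_distrib[of _ n] scalar_prod_add_distrib[of _ n]
          comm_scalar_prod[of s n r] algebra_simps)
    moreover have "t * (r \<bullet> s) = - ((r \<bullet> s)\<^sup>2 / (s \<bullet> s))"
      by (simp add: t_def power2_eq_square)
    moreover have "s \<bullet> s \<ge> 0"
      by (simp add: scalar_prod_def sum_nonneg)
    ultimately show ?thesis using rs by simp
  qed
  ultimately show ?case
    using B Cm Ci km det_addrow[of k n m B t] less_Suc_eq
    by (intro bexI[of _ ?C]) (auto simp: r_def s_def less_Suc_eq)
qed

lemma orthogonalize_rows: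
  fixes A :: "real mat"
  assumes A: "A \<in> carrier_mat n n" and "m \<le> n"
  shows "\<exists>B\<in>carrier_mat n n. det B = det A \<and> (\<forall>i<n. row B i \<bullet> row B i \<le> row A i \<bullet> row A i) \<and>
    (\<forall>i<m. \<forall>l<m. i \<noteq> l \<longrightarrow> row B i \<bullet> row B l = 0)"
  using \<open>m \<le> n\<close>
proof (induction m)
  case 0
  show ?case using A by (intro bexI[of _ A]) auto
next
  case (Suc m)
  then obtain B where B: "B \<in> carrier_mat n n" "det B = det A"
    "\<forall>i<n. row B i \<bullet> row B i \<le> row A i \<bullet> row A i"
    "\<forall>i<m. \<forall>l<m. i \<noteq> l \<longrightarrow> row B i \<bullet> row B l = 0"
    by auto
  obtain C where C: "C \<in> carrier_mat n n" "det C = det B" "\<forall>i<n. i \<noteq> m \<longrightarrow> row C i = row B i"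
    "row C m \<bullet> row C m \<le> row B m \<bullet> row B m" "\<forall>l<m. row C m \<bullet> row B l = 0"
    using orthogonalize_row[OF B(1) _ order_refl B(4)] Suc.prems by auto
  have "row C i \<bullet> row C l = 0" if "i < Suc m" "l < Suc m" "i \<noteq> l" for i l
  proof -
    have "row C l \<bullet> row C m = row C m \<bullet> row C l" if "l < m"
      using C(1) Suc.prems that by (intro comm_scalar_prod[of _ n]) auto
    moreover have "row C i \<bullet> row C m = row C m \<bullet> row C i" if "i < m"
      using C(1) Suc.prems that by (intro comm_scalar_prod[of _ n]) auto
    ultimately show ?thesis
      using that C(3,5) B(4) Suc.prems by (auto simp: less_Suc_eq)
  qed
  moreover have "row C i \<bullet> row C i \<le> row A i \<bullet> row A i" if "i < n" for i
    using that C(3,4) B(3) by (cases "i = m") (auto intro: order_trans)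
  ultimately show ?case
    using B(2) C(1,2) by (intro bexI[of _ C]) auto
qed

text \<open>After orthogonalisation the Gram matrix of the rows is diagonal, and its determinant is
  both the squared determinant and the product of the squared row lengths.\<close>

theorem hadamard_inequality:
  fixes A :: "real mat"
  assumes A: "A \<in> carrier_mat n n"
  shows "(det A)\<^sup>2 \<le> (\<Prod>i<n. row A i \<bullet> row A i)"
proof -
  obtain B where B: "B \<in> carrier_mat n n" "det B = det A"
    "\<forall>i<n. row B i \<bullet> row B i \<le> row A i \<bullet> row A i"
    "\<forall>i<n. \<forall>l<n. i \<noteq> l \<longrightarrow> row B i \<bullet> row B l = 0"
    using orthogonalize_rows[OF A order_refl] by auto
  let ?G = "B * transpose_mat B"
  have G: "?G \<in> carrier_mat n n" using B(1) by auto
  have "(det A)\<^sup>2 = det ?G"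
    using B(1,2) by (simp add: det_mult[of _ n] det_transpose[OF B(1)] power2_eq_square)
  also have "\<dots> = prod_list (diag_mat ?G)"
    by (rule det_upper_triangular[OF _ G]) (use B in \<open>auto simp: upper_triangular_def\<close>)
  also have "\<dots> = (\<Prod>i<n. row B i \<bullet> row B i)"
    using B(1) by (simp add: prod_list_diag_prod lessThan_atLeast0)
  also have "\<dots> \<le> (\<Prod>i<n. row A i \<bullet> row A i)"
    using B(3) by (intro prod_mono) (auto simp: scalar_prod_def sum_nonneg)
  finally show ?thesis .
qed

lemma det_Ints:
  assumes "A \<in> carrier_mat n n" "\<forall>i<n. \<forall>j<n. A $$ (i, j) \<in> \<int>"
  shows "det A \<in> \<int>"
  unfolding det_def'[OF assms(1)]
  by (intro Ints_sum Ints_mult Ints_prod)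
    (use assms(2) in \<open>auto simp: sign_def permutes_in_image\<close>)

text \<open>Bounding the square avoids half-integral exponents until the final length
  estimate.\<close>

lemma det_square_le:
  fixes A :: "real mat"
  assumes "A \<in> carrier_mat n n" "\<forall>i<n. \<forall>j<n. \<bar>A $$ (i, j)\<bar> \<le> 1"
  shows "(det A)\<^sup>2 \<le> real n ^ n"
proof -
  have "row A i \<bullet> row A i \<le> real n" if "i < n" for i
  proof -
    have "row A i \<bullet> row A i = (\<Sum>j<n. (A $$ (i, j))\<^sup>2)"
      using assms(1) that by (simp add: scalar_prod_def power2_eq_square lessThan_atLeast0)
    also have "\<dots> \<le> (\<Sum>j<n. 1)"
      using assms(2) that by (intro sum_mono) (auto simp: abs_square_le_1)
    finally show ?thesis by simp
  qed
  then have "(\<Prod>i<n. row A i \<bullet> row A i) \<le> (\<Prod>i<n. real n)"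
    by (intro prod_mono) (auto simp: scalar_prod_def sum_nonneg)
  then show ?thesis
    using hadamard_inequality[OF assms(1)] by simp
qed

section \<open>Integral conic combinations\<close>

text \<open>Pointwise scaling makes real-valued functions a real vector space, so that
  \<open>span\<close> and \<open>independent\<close> apply to vectors whose dimension
  \<open>n\<close> is a variable rather than a type.\<close>

instantiation "fun" :: (type, scaleR) scaleR
begin

definition "c *\<^sub>R f = (\<lambda>x. c *\<^sub>R f x)"

instance ..

end

lemma scaleR_fun_apply [simp]: "(c *\<^sub>R f) x = c *\<^sub>R f x"
  by (simp add: scaleR_fun_def)

instance "fun" :: (type, real_vector) real_vector
  by standard (simp_all add: fun_eq_iff scaleR_add_left scaleR_add_right)

lemma sum_fun_apply: "(\<Sum>a\<in>A. f a) x = (\<Sum>a\<in>A. f a x)"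
  by (induction A rule: infinite_finite_induct) auto

lemma span_indicators:
  fixes f :: "'p \<Rightarrow> real"
  assumes "finite P" "\<And>p. p \<notin> P \<Longrightarrow> f p = 0"
  shows "f \<in> span ((\<lambda>p. indicator {p}) ` P)"
proof -
  have "f = (\<Sum>p\<in>P. f p *\<^sub>R indicator {p})"
  proof
    fix x
    have "(\<Sum>p\<in>P. f p *\<^sub>R indicator {p}) x = (\<Sum>p\<in>P. if p = x then f p else 0)"
      by (auto simp: sum_fun_apply indicator_def intro!: sum.cong)
    then show "f x = (\<Sum>p\<in>P. f p *\<^sub>R indicator {p}) x"
      using assms by simp
  qed
  also have "\<dots> \<in> span ((\<lambda>p. indicator {p}) ` P)"
    by (intro span_sum span_scale span_base) auto
  finally show ?thesis .
qed

lemma independent_indicators: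
  assumes "finite P"
  shows "independent ((\<lambda>p. indicator {p} :: 'p \<Rightarrow> real) ` P)"
    "card ((\<lambda>p. indicator {p} :: 'p \<Rightarrow> real) ` P) = card P"
proof -
  let ?e = "\<lambda>p. indicator {p} :: 'p \<Rightarrow> real"
  have inj: "inj_on ?e P"
    by (auto simp: inj_on_def fun_eq_iff indicator_def split: if_splits)
  then show "card (?e ` P) = card P"
    by (rule card_image)
  show "independent (?e ` P)"
  proof (rule independent_if_scalars_zero)
    show "finite (?e ` P)" using assms by simp
  next
    fix u x assume sum: "(\<Sum>x\<in>?e ` P. u x *\<^sub>R x) = 0" and "x \<in> ?e ` P"
    then obtain p where p: "p \<in> P" "x = ?e p" by auto
    have "0 = (\<Sum>x\<in>?e ` P. u x *\<^sub>R x) p"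
      by (simp add: sum)
    also have "\<dots> = (\<Sum>q\<in>P. u (?e q) * ?e q p)"
      by (simp add: sum_fun_apply sum.reindex[OF inj])
    also have "\<dots> = u (?e p)"
      using p assms by (simp add: indicator_def if_distrib[of "\<lambda>t. _ * t"] sum.delta cong: if_cong)
    finally show "u x = 0" using p by simp
  qed
qed

text \<open>The unit vectors lie in \<open>A\<close> and span it, so the exchange bound applied in
  both directions fixes the size of a maximal independent subset. This makes the matrix for Cramer's
  rule square.\<close>

lemma basis_extending:
  fixes A :: "('p \<Rightarrow> real) set"
  assumes "finite P" "\<And>a p. a \<in> A \<Longrightarrow> p \<notin> P \<Longrightarrow> a p = 0"
    and "\<And>p. p \<in> P \<Longrightarrow> indicator {p} \<in> A" and "S \<subseteq> A" "independent S"
  obtains B where "S \<subseteq> B" "B \<subseteq> A" "independent B" "finite B" "card B = card P"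
proof -
  let ?E = "(\<lambda>p. indicator {p} :: 'p \<Rightarrow> real) ` P"
  obtain B where B: "S \<subseteq> B" "B \<subseteq> A" "independent B" "A \<subseteq> span B"
    using maximal_independent_subset_extend[OF assms(4,5)] by blast
  have "B \<subseteq> span ?E"
    using B(2) assms(1,2) span_indicators[of P] by blast
  then have "finite B \<and> card B \<le> card ?E"
    using independent_span_bound[of ?E B] B(3) assms(1) by blast
  moreover from this have "card ?E \<le> card B"
    using independent_span_bound[of B ?E] independent_indicators[OF assms(1)] B(4) assms(3)
    by blast
  ultimately show thesis
    using that B independent_indicators(2)[OF assms(1)] by simp
qed

text \<open>\<open>D\<close> is the absolute determinant of a basis matrix, and each
  \<open>m a\<close> is that of the matrix with the column of \<open>a\<close> replaced by the
  target. All entries being -1, 0 or 1, these are integers within Hadamard's bound.\<close>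

lemma integral_conic_representation:
  fixes A :: "('p \<Rightarrow> real) set"
  assumes "finite P" "finite A"
    and supp: "\<And>a p. a \<in> A \<Longrightarrow> p \<notin> P \<Longrightarrow> a p = 0" "\<And>p. p \<notin> P \<Longrightarrow> b p = 0"
    and entries: "\<And>a p. a \<in> A \<Longrightarrow> a p \<in> {-1, 0, 1}" "\<And>p. b p \<in> {-1, 0, 1}"
    and units: "\<And>p. p \<in> P \<Longrightarrow> indicator {p} \<in> A"
    and c: "\<forall>a\<in>A. c a \<ge> 0" "\<forall>p\<in>P. b p = (\<Sum>a\<in>A. c a * a p)"
  obtains B D and m :: "('p \<Rightarrow> real) \<Rightarrow> nat" where "B \<subseteq> A" "card B = card P" "D > 0"
    "\<And>a. a \<in> B \<Longrightarrow> m a ^ 2 \<le> card P ^ card P"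
    "\<And>p. p \<in> P \<Longrightarrow> real D * b p = (\<Sum>a\<in>B. real (m a) * a p)"
proof -
  define n where "n = card P"
  have "b = (\<Sum>a\<in>A. c a *\<^sub>R a)"
  proof
    fix p
    show "b p = (\<Sum>a\<in>A. c a *\<^sub>R a) p"
    proof (cases "p \<in> P")
      case True
      then show ?thesis using c(2) by (simp add: sum_fun_apply)
    next
      case False
      then have "(\<Sum>a\<in>A. c a * a p) = 0"
        by (intro sum.neutral) (simp add: supp)
      then show ?thesis using False by (simp add: sum_fun_apply supp)
    qed
  qed
  then obtain S d0 where S: "S \<subseteq> A" "independent S" "\<forall>a\<in>S. d0 a \<ge> 0" "b = (\<Sum>a\<in>S. d0 a *\<^sub>R a)"
    using caratheodory_conic[OF \<open>finite A\<close> c(1)] by force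
  obtain B where B: "S \<subseteq> B" "B \<subseteq> A" "independent B" "finite B" "card B = n"
    unfolding n_def
    by (rule basis_extending[where A = A and P = P and S = S]) (use assms(1) supp(1) units S(1,2) in auto)
  \<comment> \<open>Basis vectors added to \<open>S\<close> get coefficient zero, so the sum is
    unchanged.\<close>
  define d where "d a = (if a \<in> S then d0 a else 0)" for a
  have "(\<Sum>a\<in>B. d a *\<^sub>R a) = (\<Sum>a\<in>S. d0 a *\<^sub>R a)"
    using B(1,4) by (intro sum.mono_neutral_cong_right) (auto simp: d_def)
  then have d: "b = (\<Sum>a\<in>B. d a *\<^sub>R a)" "\<And>a. d a \<ge> 0"
    using S(3,4) by (auto simp: d_def)
  obtain f where f: "bij_betw f {..<n} B"
    using ex_bij_betw_nat_finite[OF B(4)] B(5) by (auto simp: lessThan_atLeast0)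
  obtain e where e: "bij_betw e {..<n} P"
    using ex_bij_betw_nat_finite[OF assms(1)] by (auto simp: lessThan_atLeast0 n_def)
  have fB: "f j \<in> B" if "j < n" for j
    using f that by (auto simp: bij_betw_def)
  \<comment> \<open>Columns are the basis vectors, rows the points of \<open>P\<close>, both through
    fixed enumerations.\<close>
  define M where "M = mat n n (\<lambda>(i, j). f j (e i))"
  define x where "x = vec n (\<lambda>j. d (f j))"
  have M: "M \<in> carrier_mat n n" and x: "x \<in> carrier_vec n"
    by (auto simp: M_def x_def)
  have Mv: "(M *\<^sub>v v) $ i = (\<Sum>j<n. v $ j *\<^sub>R f j) (e i)" if "i < n" "v \<in> carrier_vec n" for v i
    using that by (simp add: M_def scalar_prod_def sum_fun_apply lessThan_atLeast0 mult.commute)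
  have Mx: "M *\<^sub>v x = vec n (\<lambda>i. b (e i))"
  proof (rule eq_vecI)
    fix i assume i: "i < dim_vec (vec n (\<lambda>i. b (e i)))"
    have "(\<Sum>j<n. x $ j *\<^sub>R f j) = (\<Sum>j<n. d (f j) *\<^sub>R f j)"
      by (simp add: x_def)
    also have "\<dots> = b"
      using sum.reindex_bij_betw[OF f, of "\<lambda>a. d a *\<^sub>R a"] d(1) by simp
    finally show "(M *\<^sub>v x) $ i = vec n (\<lambda>i. b (e i)) $ i"
      using Mv[OF _ x, of i] i by simp
  qed (use M in auto)
  have "det M \<noteq> 0"
  proof
    assume "det M = 0"
    then obtain v where v: "v \<in> carrier_vec n" "v \<noteq> 0\<^sub>v n" "M *\<^sub>v v = 0\<^sub>v n"
      using det_0_iff_vec_prod_zero[OF M] by auto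
    \<comment> \<open>Inverting the enumeration turns a kernel vector of \<open>M\<close> into a
      linear dependency on \<open>B\<close>.\<close>
    define g where "g = the_inv_into {..<n} f"
    have g: "g (f j) = j" if "j < n" for j
      using f that by (simp add: g_def bij_betw_def the_inv_into_f_f)
    have "(\<Sum>a\<in>B. v $ g a *\<^sub>R a) = (\<Sum>j<n. v $ g (f j) *\<^sub>R f j)"
      by (rule sum.reindex_bij_betw[OF f, symmetric])
    also have "\<dots> = (\<Sum>j<n. v $ j *\<^sub>R f j)"
      by (simp add: g)
    also have "\<dots> = 0"
    proof
      fix p
      show "(\<Sum>j<n. v $ j *\<^sub>R f j) p = 0 p"
      proof (cases "p \<in> P")
        case True
        then obtain i where "i < n" "p = e i"
          using e by (auto simp: bij_betw_def)
        then show ?thesis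
          using Mv[OF _ v(1), of i] v(3) by simp
      next
        case False
        then have "f j p = 0" if "j < n" for j
          using supp(1) B(2) fB[OF that] by blast
        then show ?thesis
          by (simp add: sum_fun_apply)
      qed
    qed
    finally have "\<forall>a\<in>B. v $ g a = 0"
      using independentD[OF B(3,4) order_refl, of "\<lambda>a. v $ g a"] by blast
    then have "\<forall>j<n. v $ j = 0"
      using fB g by force
    then show False
      using v(1,2) by (auto simp: vec_eq_iff)
  qed
  have M_entries: "M $$ (i, j) \<in> {-1, 0, 1}" if "i < n" "j < n" for i j
    using entries(1) B(2) fB that by (auto simp: M_def)
  then have "det M \<in> \<int>"
    by (intro det_Ints[OF M]) (metis Ints_0 Ints_1 Ints_minus insert_iff singletonD)
  then obtain z where z: "det M = real_of_int z"
    by (auto elim: Ints_cases)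
  define D where "D = nat \<bar>z\<bar>"
  have D: "D > 0" "real D = \<bar>det M\<bar>"
    using \<open>det M \<noteq> 0\<close> by (auto simp: D_def z)
  have "\<exists>k::nat. real k = real D * d a \<and> k ^ 2 \<le> n ^ n" if a: "a \<in> B" for a
  proof -
    obtain j where j: "j < n" "a = f j"
      using f a by (auto simp: bij_betw_def)
    let ?R = "replace_col M (M *\<^sub>v x) j"
    have R: "?R \<in> carrier_mat n n"
      using M by (auto simp: replace_col_def)
    have "?R $$ (i, l) \<in> {-1, 0, 1}" if "i < n" "l < n" for i l
      using that M M_entries[of i l] entries(2)[of "e i"] by (auto simp: replace_col_def Mx)
    then have R_entries: "?R $$ (i, l) \<in> \<int>" "\<bar>?R $$ (i, l)\<bar> \<le> 1" if "i < n" "l < n" for i l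
      using that by (metis Ints_0 Ints_1 Ints_minus insert_iff singletonD, force)
    have "det ?R \<in> \<int>"
      by (intro det_Ints[OF R]) (use R_entries in auto)
    then obtain y where y: "det ?R = real_of_int y"
      by (auto elim: Ints_cases)
    have "det ?R = d a * det M"
      using cramer_lemma_mat[OF M x j(1)] j by (simp add: x_def)
    \<comment> \<open>Since \<open>d a\<close> is nonnegative, absolute values dispose of the
      unknown sign of \<open>det M\<close>.\<close>
    then have "\<bar>det ?R\<bar> = real D * d a"
      using d(2) by (simp add: D abs_mult)
    then have eq: "real (nat \<bar>y\<bar>) = real D * d a"
      by (simp add: y)
    have "real (nat \<bar>y\<bar> ^ 2) = (det ?R)\<^sup>2"
      by (simp add: y)
    also have "\<dots> \<le> real n ^ n"
      by (intro det_square_le[OF R]) (use R_entries in auto)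
    finally have "nat \<bar>y\<bar> ^ 2 \<le> n ^ n"
      by (metis of_nat_le_iff of_nat_power)
    with eq show ?thesis by blast
  qed
  then obtain m where m: "\<And>a. a \<in> B \<Longrightarrow> real (m a) = real D * d a \<and> m a ^ 2 \<le> n ^ n"
    by metis
  have "real D * b p = (\<Sum>a\<in>B. real (m a) * a p)" for p
    using m by (subst d(1)) (simp add: sum_fun_apply sum_distrib_left mult.assoc)
  then show thesis
    using that[of B D m] B m D n_def by simp
qed

section \<open>Simple games\<close>

lemma sum_weights_diff_vec:
  assumes "finite P" "X \<subseteq> P" "Y \<subseteq> P"
  shows "(\<Sum>i\<in>P. diff_vec X Y i * w i) = sum w X - sum w Y"
proof -
  have "(\<Sum>i\<in>P. indicator Z i * w i) = sum w Z" if "Z \<subseteq> P" for Z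
    using assms(1) that by (simp add: indicator_def if_distrib[of "\<lambda>t. t * _"] sum.If_cases Int_absorb1 cong: if_cong)
  then show ?thesis
    using assms by (simp add: diff_vec_def left_diff_distrib sum_subtractf)
qed

lemma finite_players [simp]: "finite (players n)"
  by (simp add: players_def)

lemma card_players [simp]: "card (players n) = n"
  by (simp add: players_def)

text \<open>Without players the empty set is the only coalition, so a nonempty \<open>W\<close>
  would be the whole power set.\<close>

lemma simple_game_positive:
  assumes "simple_game n W"
  shows "n > 0"
proof (rule ccontr)
  assume "\<not> n > 0"
  then have "Pow (players n) = {{}}" by (simp add: players_def)
  with assms show False
    unfolding simple_game_def by (metis subset_singletonD)
qed

lemma winning_subset: "simple_game n W \<Longrightarrow> X \<in> W \<Longrightarrow> X \<subseteq> players n"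
  by (auto simp: simple_game_def)

lemma losing_subset: "Y \<in> losing n W \<Longrightarrow> Y \<subseteq> players n"
  by (auto simp: losing_def)

lemma players_winning: "simple_game n W \<Longrightarrow> players n \<in> W"
  unfolding simple_game_def by blast

lemma losing_mono: "simple_game n W \<Longrightarrow> Y \<in> losing n W \<Longrightarrow> Z \<subseteq> Y \<Longrightarrow> Z \<in> losing n W"
  unfolding simple_game_def losing_def by blast

lemma empty_losing:
  assumes "simple_game n W"
  shows "{} \<in> losing n W"
proof -
  obtain Y where "Y \<in> losing n W"
    using assms by (auto simp: simple_game_def losing_def)
  then show ?thesis
    using losing_mono[OF assms] by blast
qed

lemma finite_game_vecs:
  assumes "simple_game n W"
  shows "finite (game_vecs n W)"
proof -
  have "game_vecs n W \<subseteq> (\<lambda>(X, Y). diff_vec X Y) ` (Pow (players n) \<times> Pow (players n))"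
    using winning_subset[OF assms] losing_subset by (fastforce simp: game_vecs_def)
  then show ?thesis
    by (rule finite_subset) simp
qed

section \<open>Rough weights as linear forms, and their incompatibility with relations and
  certificates\<close>

text \<open>This eliminates the quota: it exists as soon as no losing coalition outweighs a winning
  one.\<close>

lemma roughly_weighted_iff_nonneg_form:
  assumes G: "simple_game n W"
  shows "roughly_weighted n W \<longleftrightarrow>
    (\<exists>w. (\<forall>i\<in>players n. w i \<ge> 0) \<and> (\<exists>i\<in>players n. w i \<noteq> 0) \<and>
      (\<forall>v\<in>game_vecs n W. (\<Sum>i\<in>players n. v i * w i) \<ge> 0))"
    (is "_ \<longleftrightarrow> ?R")
proof
  assume "roughly_weighted n W"
  then obtain w and q :: real
    where w: "\<forall>i\<in>players n. w i \<ge> 0" "q \<noteq> 0 \<or> (\<exists>i\<in>players n. w i \<noteq> 0)"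
    and W: "\<forall>X\<subseteq>players n. (sum w X < q \<longrightarrow> X \<in> losing n W) \<and> (sum w X > q \<longrightarrow> X \<in> W)"
    unfolding roughly_weighted_def by blast
  have win: "sum w X \<ge> q" if "X \<in> W" for X
    using W winning_subset[OF G that] that unfolding losing_def by (meson DiffD2 not_le)
  have lose: "sum w Y \<le> q" if "Y \<in> losing n W" for Y
    using W losing_subset[OF that] that unfolding losing_def by (meson DiffD2 not_le)
  \<comment> \<open>If all weights vanished, the losing empty coalition and the winning grand
    coalition would force \<open>q = 0\<close> as well, against nontriviality.\<close>
  have "sum w (players n) \<noteq> 0"
  proof
    assume "sum w (players n) = 0"
    moreover have "q \<ge> 0"
      using lose[OF empty_losing[OF G]] by simp
    ultimately have "q = 0"
      using win[OF players_winning[OF G]] by simp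
    moreover have "\<forall>i\<in>players n. w i = 0"
      using \<open>sum w (players n) = 0\<close> w(1) by (simp add: sum_nonneg_eq_0_iff)
    ultimately show False
      using w(2) by blast
  qed
  then have "\<exists>i\<in>players n. w i \<noteq> 0"
    by (meson sum.neutral)
  moreover have "(\<Sum>i\<in>players n. v i * w i) \<ge> 0" if v: "v \<in> game_vecs n W" for v
  proof -
    obtain X Y where XY: "v = diff_vec X Y" "X \<in> W" "Y \<in> losing n W"
      using v by (auto simp: game_vecs_def)
    then show ?thesis
      using win[OF XY(2)] lose[OF XY(3)]
      by (simp add: sum_weights_diff_vec winning_subset[OF G] losing_subset)
  qed
  ultimately show ?R
    using w(1) by blast
next
  assume ?R
  then obtain w where w: "\<forall>i\<in>players n. w i \<ge> 0" "\<exists>i\<in>players n. w i \<noteq> 0"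
    "\<And>v. v \<in> game_vecs n W \<Longrightarrow> (\<Sum>i\<in>players n. v i * w i) \<ge> 0"
    by blast
  have le: "sum w Y \<le> sum w X" if "X \<in> W" "Y \<in> losing n W" for X Y
    using w(3)[of "diff_vec X Y"] that winning_subset[OF G that(1)] losing_subset[OF that(2)]
    by (auto simp: game_vecs_def sum_weights_diff_vec)
  \<comment> \<open>The weight of the heaviest losing coalition serves as quota.\<close>
  define q where "q = Max (sum w ` losing n W)"
  have fin: "finite (sum w ` losing n W)" and ne: "sum w ` losing n W \<noteq> {}"
    using empty_losing[OF G] by (auto simp: losing_def)
  have "q \<in> sum w ` losing n W"
    unfolding q_def using fin ne by (rule Max_in)
  then have win: "sum w X \<ge> q" if "X \<in> W" for X
    using le that by auto
  have lose: "sum w Y \<le> q" if "Y \<in> losing n W" for Y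
    unfolding q_def using fin that by (intro Max_ge) auto
  have W: "(sum w X < q \<longrightarrow> X \<in> losing n W) \<and> (sum w X > q \<longrightarrow> X \<in> W)" if "X \<subseteq> players n" for X
    using that win[of X] lose[of X] by (cases "X \<in> W") (auto simp: losing_def)
  show "roughly_weighted n W"
    unfolding roughly_weighted_def
    by (intro exI[of _ w] exI[of _ q] conjI disjI2 allI impI) (use w(1,2) W in blast)+
qed

lemma roughly_weighted_no_relation:
  fixes j :: nat
  assumes G: "simple_game n W" and "roughly_weighted n W"
    and v: "\<forall>k<j. v k \<in> game_vecs n W"
  shows "\<not> (\<forall>i\<in>players n. (\<Sum>k<j. v k i) + 1 = 0)"
proof
  assume rel: "\<forall>i\<in>players n. (\<Sum>k<j. v k i) + 1 = 0"
  obtain w where w: "\<forall>i\<in>players n. w i \<ge> 0" "\<exists>i\<in>players n. w i \<noteq> 0"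
    "\<And>v. v \<in> game_vecs n W \<Longrightarrow> (\<Sum>i\<in>players n. v i * w i) \<ge> 0"
    using assms(2) unfolding roughly_weighted_iff_nonneg_form[OF G] by blast
  have "0 \<le> (\<Sum>k<j. \<Sum>i\<in>players n. v k i * w i)"
    by (rule sum_nonneg) (use w(3) v in auto)
  also have "\<dots> = (\<Sum>i\<in>players n. (\<Sum>k<j. v k i) * w i)"
    by (subst sum.swap) (simp add: sum_distrib_right)
  also have "\<dots> = - sum w (players n)"
    using rel by (simp add: eq_neg_iff_add_eq_0[symmetric] sum_negf)
  finally have "sum w (players n) = 0"
    using w(1) by (intro antisym sum_nonneg) auto
  then show False
    using w(1,2) by (simp add: sum_nonneg_eq_0_iff)
qed

lemma real_card_less_indicator:
  fixes j :: nat
  shows "real (card {k. k < j \<and> i \<in> F k}) = (\<Sum>k<j. indicator (F k) i)"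
proof -
  have "{k. k < j \<and> i \<in> F k} = {..<j} \<inter> {k. i \<in> F k}" by auto
  then show ?thesis by (simp add: indicator_def sum_of_bool_eq)
qed

lemma trading_transform_alt:
  "trading_transform n j Xs Ys \<longleftrightarrow> length Xs = j \<and> length Ys = j \<and>
     set Xs \<subseteq> Pow (players n) \<and> set Ys \<subseteq> Pow (players n) \<and>
     (\<forall>i\<in>players n. (\<Sum>k<j. diff_vec (Xs ! k) (Ys ! k) i) = 0)"
proof -
  have "card {k. k < j \<and> i \<in> Xs ! k} = card {k. k < j \<and> i \<in> Ys ! k}
      \<longleftrightarrow> (\<Sum>k<j. diff_vec (Xs ! k) (Ys ! k) i) = 0" for i
    unfolding diff_vec_def sum_subtractf real_card_less_indicator[symmetric] by simp
  then show ?thesis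
    by (simp add: trading_transform_def)
qed

text \<open>The weight differences of the pairs are nonnegative with sum zero, hence all zero. So
  the coalition paired with the grand one is losing with full weight, the one paired with the empty
  set is winning with weight zero, and comparing them gives total weight zero.\<close>

lemma roughly_weighted_no_potent_certificate:
  assumes G: "simple_game n W" and "roughly_weighted n W"
  shows "\<not> potent_certificate n W j Xs Ys"
proof
  assume cert: "potent_certificate n W j Xs Ys"
  then have tt: "length Xs = j" "length Ys = j"
    "\<forall>i\<in>players n. (\<Sum>k<j. diff_vec (Xs ! k) (Ys ! k) i) = 0"
    and sets: "set Xs \<subseteq> W" "set Ys \<subseteq> losing n W" "players n \<in> set Xs" "{} \<in> set Ys"
    by (auto simp: potent_certificate_def certificate_nonweighted_def trading_transform_alt)
  obtain w where w: "\<forall>i\<in>players n. w i \<ge> 0" "\<exists>i\<in>players n. w i \<noteq> 0"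
    "\<And>v. v \<in> game_vecs n W \<Longrightarrow> (\<Sum>i\<in>players n. v i * w i) \<ge> 0"
    using assms(2) unfolding roughly_weighted_iff_nonneg_form[OF G] by blast
  have le: "sum w Y \<le> sum w X" if "X \<in> W" "Y \<in> losing n W" for X Y
    using w(3)[of "diff_vec X Y"] that winning_subset[OF G that(1)] losing_subset[OF that(2)]
    by (auto simp: game_vecs_def sum_weights_diff_vec)
  have win: "Xs ! k \<in> W" and lose: "Ys ! k \<in> losing n W" if "k < j" for k
    using subsetD[OF sets(1) nth_mem] subsetD[OF sets(2) nth_mem] tt(1,2) that by simp_all
  have "(\<Sum>k<j. sum w (Xs ! k) - sum w (Ys ! k))
      = (\<Sum>k<j. \<Sum>i\<in>players n. diff_vec (Xs ! k) (Ys ! k) i * w i)"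
    using winning_subset[OF G win] losing_subset[OF lose]
    by (intro sum.cong refl) (simp add: sum_weights_diff_vec)
  also have "\<dots> = (\<Sum>i\<in>players n. (\<Sum>k<j. diff_vec (Xs ! k) (Ys ! k) i) * w i)"
    by (subst sum.swap) (simp add: sum_distrib_right)
  also have "\<dots> = 0"
    using tt(3) by simp
  finally have "\<forall>k<j. sum w (Xs ! k) - sum w (Ys ! k) = 0"
    using le win lose by (subst (asm) sum_nonneg_eq_0_iff) auto
  then have eq: "\<forall>k<j. sum w (Xs ! k) = sum w (Ys ! k)"
    by simp
  obtain k l where kl: "k < j" "Xs ! k = players n" "l < j" "Ys ! l = {}"
    using sets(3,4) tt(1,2) by (metis in_set_conv_nth)
  have "sum w (players n) \<le> sum w (Xs ! l)"
    using le[OF win[OF kl(3)] lose[OF kl(1)]] eq[rule_format, OF kl(1)] kl(2) by simp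
  also have "\<dots> = 0"
    using eq kl by simp
  finally have "sum w (players n) = 0"
    using w(1) by (intro antisym sum_nonneg) auto
  then show False
    using w(1,2) by (simp add: sum_nonneg_eq_0_iff)
qed

text \<open>Taking player \<open>i\<close> out of one losing coalition raises coordinate \<open>i\<close> of the sum by 1, so a surplus
  in the negative direction can be removed coordinate by coordinate, without changing the number of
  vectors.\<close>

lemma relation_absorb:
  fixes j :: nat
  assumes G: "simple_game n W" and v: "\<forall>k<j. v k \<in> game_vecs n W"
    and rel: "\<forall>i\<in>players n. (\<Sum>k<j. v k i) = - (1 + real (b i))"
  shows "\<exists>X Y. (\<forall>k<j. X k \<in> W \<and> Y k \<in> losing n W) \<and>
    (\<forall>i\<in>players n. (\<Sum>k<j. diff_vec (X k) (Y k) i) = -1)"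
proof -
  obtain X Y where XY: "\<forall>k<j. v k = diff_vec (X k) (Y k) \<and> X k \<in> W \<and> Y k \<in> losing n W"
    using v unfolding game_vecs_def mem_Collect_eq by metis
  have "\<exists>K. K \<subseteq> {k. k < j \<and> i \<in> Y k} \<and> card K = b i" if "i \<in> players n" for i
  proof -
    let ?N = "{k. k < j \<and> i \<in> Y k}"
    \<comment> \<open>Dropping the contribution of the winning coalitions shows that enough losing
      coalitions contain player \<open>i\<close>.\<close>
    have "- real (card ?N) = (\<Sum>k<j. - indicator (Y k) i)"
      by (simp add: real_card_less_indicator sum_negf)
    also have "\<dots> \<le> (\<Sum>k<j. v k i)"
      using XY by (intro sum_mono) (simp add: diff_vec_def)
    also have "\<dots> = - (1 + real (b i))"
      using rel that by blast
    finally have "b i \<le> card ?N" by simp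
    then show ?thesis by (meson obtain_subset_with_card_n)
  qed
  then obtain K where K: "\<And>i. i \<in> players n \<Longrightarrow> K i \<subseteq> {k. k < j \<and> i \<in> Y k}"
    "\<And>i. i \<in> players n \<Longrightarrow> card (K i) = b i"
    by metis
  \<comment> \<open>The choices \<open>K i\<close> for different players do not interact, because
    each removal affects only its own coordinate.\<close>
  define Z where "Z k = {i\<in>Y k. k \<notin> K i}" for k
  have "(\<Sum>k<j. diff_vec (X k) (Z k) i) = -1" if i: "i \<in> players n" for i
  proof -
    have "diff_vec (X k) (Z k) i = v k i + indicator (K i) k" if "k < j" for k
      using K(1)[OF i] XY that by (auto simp: Z_def diff_vec_def indicator_def)
    then have "(\<Sum>k<j. diff_vec (X k) (Z k) i) = (\<Sum>k<j. v k i) + (\<Sum>k<j. indicator (K i) k)"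
      by (simp add: sum.distrib)
    also have "{..<j} \<inter> K i = K i"
      using K(1)[OF i] by auto
    then have "(\<Sum>k<j. indicator (K i) k) = real (b i)"
      using K(2)[OF i] by (simp add: indicator_def sum_of_bool_eq)
    finally show ?thesis
      using rel i by simp
  qed
  moreover have "Z k \<in> losing n W" if "k < j" for k
    using losing_mono[OF G, of "Y k"] XY that by (auto simp: Z_def)
  ultimately show ?thesis
    using XY by blast
qed

text \<open>A test vector \<open>y\<close> in Farkas' lemma is nonpositive because of the unit
  vectors, so a nonzero \<open>y\<close> would make \<open>-y\<close> a system of rough
  weights.\<close>

lemma conic_representation_if_not_roughly_weighted:
  assumes G: "simple_game n W" and "\<not> roughly_weighted n W"
  defines "A \<equiv> game_vecs n W \<union> (\<lambda>p. indicator {p}) ` players n"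
  shows "\<exists>c. (\<forall>a\<in>A. c a \<ge> 0) \<and> (\<forall>i\<in>players n. - 1 = (\<Sum>a\<in>A. c a * a i))"
proof (rule farkas)
  show "finite A"
    unfolding A_def by (simp add: finite_game_vecs[OF G])
  fix y assume y: "\<forall>a\<in>A. (\<Sum>i\<in>players n. a i * y i) \<le> 0"
  have neg: "y p \<le> 0" if "p \<in> players n" for p
  proof -
    have "(\<Sum>i\<in>players n. indicator {p} i * y i) = (\<Sum>i\<in>players n. if i = p then y i else 0)"
      by (intro sum.cong) auto
    moreover have "(\<Sum>i\<in>players n. indicator {p} i * y i) \<le> 0"
      using y that unfolding A_def by blast
    ultimately show ?thesis
      using that by simp
  qed
  have "\<forall>i\<in>players n. y i = 0"
  proof (rule ccontr)
    assume "\<not> (\<forall>i\<in>players n. y i = 0)"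
    then have "roughly_weighted n W"
      unfolding roughly_weighted_iff_nonneg_form[OF G] using neg y
      by (intro exI[of _ "\<lambda>i. - y i"]) (auto simp: A_def sum_negf)
    with assms(2) show False by contradiction
  qed
  then show "(\<Sum>i\<in>players n. -1 * y i) \<le> 0" by simp
qed simp

section \<open>From integral coefficients to a relation of bounded length\<close>

text \<open>Multiplicities become repetitions. Quantifying over \<open>g\<close> after
  \<open>v\<close> lets one sequence serve all coordinates.\<close>

lemma replicate_family:
  fixes m :: "'a \<Rightarrow> nat"
  assumes "finite B"
  shows "\<exists>v. (\<forall>k<sum m B. v k \<in> B) \<and> (\<forall>g::'a \<Rightarrow> real. (\<Sum>k<sum m B. g (v k)) = (\<Sum>a\<in>B. real (m a) * g a))"
  using assms
proof (induction B rule: finite_induct)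
  case empty
  show ?case by simp
next
  case (insert a B)
  then obtain v where v: "\<forall>k<sum m B. v k \<in> B"
    "\<And>g::'a \<Rightarrow> real. (\<Sum>k<sum m B. g (v k)) = (\<Sum>a\<in>B. real (m a) * g a)"
    by auto
  define u where "u k = (if k < sum m B then v k else a)" for k
  have "(\<Sum>k<sum m B + t. g (u k)) = (\<Sum>k<sum m B. g (v k)) + real t * g a" for t and g :: "'a \<Rightarrow> real"
    by (induction t) (auto simp: u_def algebra_simps)
  from this[of _ "m a"] show ?case
    using insert.hyps v by (intro exI[of _ u]) (auto simp: u_def add.commute)
qed

lemma length_bound_eq:
  assumes "n > 0"
  shows "length_bound n = (real n + 1) * sqrt (real n ^ n)"
proof -
  have "2 powr (1 / 2 * real n * log 2 (real n)) = real n powr (real n * (1 / 2))"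
    using assms by (simp add: powr_def log_def)
  also have "\<dots> = sqrt (real n ^ n)"
    using assms by (simp only: powr_powr[symmetric] powr_half_sqrt powr_ge_zero)
      (simp add: powr_realpow)
  finally show ?thesis
    by (simp add: length_bound_def)
qed

text \<open>At most \<open>n\<close> basis vectors, each repeated at most
  \<open>sqrt (n ^ n)\<close> times, leave one summand \<open>sqrt (n ^ n)\<close> of
  \<open>length_bound n\<close> for a further pair.\<close>

lemma short_relation_if_not_roughly_weighted:
  assumes G: "simple_game n W" and "\<not> roughly_weighted n W"
  shows "\<exists>j X Y. 0 < j \<and> real (Suc j) \<le> length_bound n \<and>
    (\<forall>k<j. X k \<in> W \<and> Y k \<in> losing n W) \<and>
    (\<forall>i\<in>players n. (\<Sum>k<j. diff_vec (X k) (Y k) i) = -1)"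
proof -
  let ?P = "players n" and ?I = "game_vecs n W"
  let ?E = "(\<lambda>p. indicator {p} :: nat \<Rightarrow> real) ` ?P"
  obtain c where c: "\<forall>a\<in>?I \<union> ?E. c a \<ge> 0" "\<forall>i\<in>?P. - 1 = (\<Sum>a\<in>?I \<union> ?E. c a * a i)"
    using conic_representation_if_not_roughly_weighted[OF assms] by blast
  have fin: "finite (?I \<union> ?E)"
    by (simp add: finite_game_vecs[OF G])
  have supp: "a p = 0" if "a \<in> ?I \<union> ?E" "p \<notin> ?P" for a p
    using that
    by (auto simp: game_vecs_def diff_vec_def indicator_def dest!: winning_subset[OF G] losing_subset)
  have entries: "a p \<in> {-1, 0, 1}" if "a \<in> ?I \<union> ?E" for a p
    using that by (auto simp: game_vecs_def diff_vec_def indicator_def)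
  \<comment> \<open>The indicator replaces the constant -1 because the target has to vanish outside
    the players.\<close>
  have c': "\<forall>i\<in>?P. - indicator ?P i = (\<Sum>a\<in>?I \<union> ?E. c a * a i)"
    using c(2) by simp
  obtain B D and m :: "(nat \<Rightarrow> real) \<Rightarrow> nat" where B: "B \<subseteq> ?I \<union> ?E" "card B = n" "D > 0"
    and m: "\<And>a. a \<in> B \<Longrightarrow> m a ^ 2 \<le> n ^ n"
    and rel: "\<And>i. i \<in> ?P \<Longrightarrow> real D * - indicator ?P i = (\<Sum>a\<in>B. real (m a) * a i)"
    by (rule integral_conic_representation[where P = ?P and A = "?I \<union> ?E" and c = c
          and b = "\<lambda>i. - indicator ?P i"])
      (use fin supp entries c(1) c' in \<open>auto simp: indicator_def\<close>)
  have finB: "finite B"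
    using B(1) fin by (rule finite_subset)
  \<comment> \<open>Moving the unit vectors \<open>B2\<close> to the other side only makes the right-hand side more negative;
    \<open>relation_absorb\<close> then takes care of them.\<close>
  define B1 where "B1 = B \<inter> ?I"
  define B2 where "B2 = B - ?I"
  have B12: "B = B1 \<union> B2" "B1 \<inter> B2 = {}" "finite B1" "finite B2"
    using finB by (auto simp: B1_def B2_def)
  define j where "j = sum m B1"
  obtain v where v: "\<forall>k<j. v k \<in> B1"
    "\<And>g::(nat \<Rightarrow> real) \<Rightarrow> real. (\<Sum>k<j. g (v k)) = (\<Sum>a\<in>B1. real (m a) * g a)"
    using replicate_family[OF B12(3), of m] unfolding j_def by blast
  have "\<exists>b. (\<Sum>k<j. v k i) = - (1 + real b)" if i: "i \<in> ?P" for i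
  proof -
    \<comment> \<open>Vectors in \<open>B2\<close> are unit vectors, so their contribution at
      \<open>i\<close> is a natural number.\<close>
    define s where "s = (\<Sum>a\<in>B2. m a * (if a i = 1 then 1 else 0))"
    have "a i = (if a i = 1 then 1 else 0)" if "a \<in> B2" for a
      using that B(1) by (auto simp: B2_def indicator_def)
    then have "(\<Sum>a\<in>B2. real (m a) * a i) = (\<Sum>a\<in>B2. real (m a) * (if a i = 1 then 1 else 0))"
      by (intro sum.cong refl) metis
    also have "\<dots> = real s"
      unfolding s_def of_nat_sum by (intro sum.cong) auto
    finally have "- real D = (\<Sum>k<j. v k i) + real s"
      using rel[OF i] i v(2)[of "\<lambda>a. a i"] B12 by (simp add: sum.union_disjoint)
    then show ?thesis
      \<comment> \<open>One unit of \<open>D\<close> provides the required -1; the other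
        \<open>D - 1\<close> join \<open>s\<close> as surplus.\<close>
      using B(3) by (intro exI[of _ "D - 1 + s"]) (simp add: of_nat_diff)
  qed
  then obtain b where b: "\<forall>i\<in>?P. (\<Sum>k<j. v k i) = - (1 + real (b i))"
    by metis
  then obtain X Y where XY: "\<forall>k<j. X k \<in> W \<and> Y k \<in> losing n W"
    "\<forall>i\<in>?P. (\<Sum>k<j. diff_vec (X k) (Y k) i) = -1"
    using relation_absorb[OF G, of j v b] v(1) by (auto simp: B1_def)
  have n: "n > 0" by (rule simple_game_positive[OF G])
  then have "1 \<in> ?P" by (simp add: players_def)
  \<comment> \<open>For \<open>j = 0\<close> the empty sum at player 1 would be 0 instead of
    -1.\<close>
  with XY(2) have "j > 0" by (intro gr0I) auto
  moreover have "real (Suc j) \<le> length_bound n"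
  proof -
    have "real (m a) \<le> sqrt (real n ^ n)" if "a \<in> B" for a
      using m[OF that] by (intro real_le_rsqrt) (metis of_nat_le_iff of_nat_power)
    then have "real j \<le> real (card B1) * sqrt (real n ^ n)"
      unfolding j_def of_nat_sum by (intro sum_bounded_above) (auto simp: B1_def)
    also have "\<dots> \<le> real n * sqrt (real n ^ n)"
      using card_mono[OF finB, of B1] B(2) by (intro mult_right_mono) (auto simp: B1_def)
    finally have "real j \<le> real n * sqrt (real n ^ n)" .
    moreover have "1 \<le> sqrt (real n ^ n)"
      using n by (simp add: one_le_power)
    ultimately show ?thesis
      unfolding length_bound_eq[OF n] of_nat_Suc distrib_right by linarith
  qed
  ultimately show ?thesis
    using XY by blast
qed

text \<open>The additional pair of grand and empty coalition contributes the all-ones vector, which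
  cancels the -1 in every coordinate.\<close>

lemma potent_certificate_of_relation:
  assumes G: "simple_game n W" and XY: "\<forall>k<j. X k \<in> W \<and> Y k \<in> losing n W"
    and rel: "\<forall>i\<in>players n. (\<Sum>k<j. diff_vec (X k) (Y k) i) = -1"
  shows "potent_certificate n W (Suc j) (players n # map X [0..<j]) ({} # map Y [0..<j])"
proof -
  let ?Xs = "players n # map X [0..<j]" and ?Ys = "{} # map Y [0..<j]"
  have sets: "set ?Xs \<subseteq> W" "set ?Ys \<subseteq> losing n W"
    using XY players_winning[OF G] empty_losing[OF G] by auto
  then have "set ?Xs \<subseteq> Pow (players n)" "set ?Ys \<subseteq> Pow (players n)"
    using winning_subset[OF G] losing_subset by blast+
  moreover have "(\<Sum>k<Suc j. diff_vec (?Xs ! k) (?Ys ! k) i) = 0" if "i \<in> players n" for i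
    using rel that by (simp add: sum.lessThan_Suc_shift diff_vec_def[of "players n"] del: sum.lessThan_Suc)
  ultimately show ?thesis
    unfolding potent_certificate_def certificate_nonweighted_def trading_transform_alt
    using sets by (simp del: sum.lessThan_Suc)
qed

theorem theorem7:
  fixes n :: nat and W :: "nat set set"
  assumes "simple_game n W"
  shows "(no_potent_certificate n W \<longleftrightarrow> no_vector_relation n W) \<and>
         (roughly_weighted n W \<longleftrightarrow> no_potent_certificate n W \<and> no_vector_relation n W)"
proof -
  have "no_potent_certificate n W" "no_vector_relation n W" if "roughly_weighted n W"
    unfolding no_potent_certificate_def no_vector_relation_def
    using roughly_weighted_no_potent_certificate[OF assms that]
      roughly_weighted_no_relation[OF assms that]
    by blast+
  moreover have "\<not> no_potent_certificate n W" "\<not> no_vector_relation n W"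
    if rw: "\<not> roughly_weighted n W"
  proof -
    obtain j X Y where j: "0 < j" "real (Suc j) \<le> length_bound n"
      and XY: "\<forall>k<j. X k \<in> W \<and> Y k \<in> losing n W"
      and rel: "\<forall>i\<in>players n. (\<Sum>k<j. diff_vec (X k) (Y k) i) = -1"
      using short_relation_if_not_roughly_weighted[OF assms rw] by blast
    show "\<not> no_potent_certificate n W"
      using potent_certificate_of_relation[OF assms XY rel] j(2)
      unfolding no_potent_certificate_def by blast
    have "\<forall>k<j. diff_vec (X k) (Y k) \<in> game_vecs n W"
      using XY by (auto simp: game_vecs_def)
    moreover have "real j \<le> length_bound n"
      using j(2) by simp
    ultimately show "\<not> no_vector_relation n W"
      unfolding no_vector_relation_def using j(1) rel
      by (auto intro!: exI[of _ j] exI[of _ "\<lambda>k. diff_vec (X k) (Y k)"])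
  qed
  ultimately show ?thesis by blast
qed

end
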